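(* For every $d\ge 2$ and $k\ge 1$, the digraph $\mathbb{Z}(\vec K_{d+1},k)$ is a two-ended digraph with in- and out-valency equal to $d$ which is sharply $k$-arc-transitive.
   Context: A digraph $\Gamma$ is a pair $(\mathrm V\Gamma,\mathrm E\Gamma)$ with $\mathrm E\Gamma\subseteq \mathrm V\Gamma\times \mathrm V\Gamma$ the set of arcs. The in-valency (out-valency) of a vertex $v$ is the number of $u$ with $(u,v)\in \mathrm E\Gamma$ (respectively $(v,u)\in \mathrm E\Gamma$). A $k$-arc is a sequence $(v_0,\dots,v_k)$ of vertices with $(v_{i-1},v_i)$ an arc for $1\le i\le k$. $\Gamma$ is $k$-arc-transitive if $\mathrm{Aut}(\Gamma)$ acts transitively on the set of $k$-arcs; sharply $k$-arc-transitive means $k$-arc-transitive but not $(k+1)$-arc-transitive. For a digraph $\Delta$ with vertex set $V$ and a positive integer $k$, $\mathbb{Z}(\Delta,k)$ is the digraph with vertex set $\mathbb{Z}\times V^k$ in which the out-neighbours of $(i;v_0,\dots,v_{k-1})$ are the vertices $(i+1;w_0,\dots,w_{k-1})$ such that $v_j=w_j$ if $j\not\equiv i \pmod k$, and $(v_j,w_j)\in \mathrm E\Delta$ if $j\equiv i\pmod k$. $\vec K_{d}$ is the complete digraph on $d$ vertices: $(v,w)$ is an arc exactly when $v\ne w$. A digraph has two ends (is two-ended) if it (i.e. its underlying undirected graph) is connected and by removing some finite set of vertices it is possible to get two infinite components, but one never gets more than two infinite components by removing a finite set of vertices. *)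

theory Defs
  imports "Graph_Theory.Graph_Theory" "HOL-Number_Theory.Cong"
begin

text \<open>Digraphs without parallel arcs, possibly infinite, are the records
  \<^typ>\<open>'a pair_pre_digraph\<close> satisfying \<^locale>\<open>pair_wf_digraph\<close>.\<close>

definition digraph_automorphisms :: "'a pair_pre_digraph \<Rightarrow> ('a \<Rightarrow> 'a) set" where
  "digraph_automorphisms G = {f. bij_betw f (pverts G) (pverts G) \<and>
     (\<forall>u\<in>pverts G. \<forall>v\<in>pverts G. (u, v) \<in> parcs G \<longleftrightarrow> (f u, f v) \<in> parcs G)}"

definition k_arcs :: "'a pair_pre_digraph \<Rightarrow> nat \<Rightarrow> 'a list set" where
  "k_arcs G k = {p. length p = k + 1 \<and> set p \<subseteq> pverts G \<and>
     (\<forall>i\<in>{1..k}. (p ! (i - 1), p ! i) \<in> parcs G)}"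

definition k_arc_transitive :: "'a pair_pre_digraph \<Rightarrow> nat \<Rightarrow> bool" where
  "k_arc_transitive G k \<longleftrightarrow>
     (\<forall>p\<in>k_arcs G k. \<forall>q\<in>k_arcs G k. \<exists>f\<in>digraph_automorphisms G. map f p = q)"

definition sharply_k_arc_transitive :: "'a pair_pre_digraph \<Rightarrow> nat \<Rightarrow> bool" where
  "sharply_k_arc_transitive G k \<longleftrightarrow> k_arc_transitive G k \<and> \<not> k_arc_transitive G (k + 1)"

text \<open>The components of a digraph are those of its underlying undirected graph, that is, the
  strongly connected components of its symmetric closure.\<close>

definition components :: "('a, 'b) pre_digraph \<Rightarrow> 'a set set" where
  "components G = pre_digraph.sccs_verts (with_proj (mk_symmetric G))"

definition infinite_components_without :: "('a, 'b) pre_digraph \<Rightarrow> 'a set \<Rightarrow> 'a set set" where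
  "infinite_components_without G S = {C \<in> components (G \<restriction> (verts G - S)). infinite C}"

text \<open>\<^const>\<open>card\<close> is 0 on infinite sets, hence the explicit finiteness in the upper bound.\<close>

definition two_ended :: "('a, 'b) pre_digraph \<Rightarrow> bool" where
  "two_ended G \<longleftrightarrow> connected G \<and>
     (\<exists>S. finite S \<and> S \<subseteq> verts G \<and> card (infinite_components_without G S) = 2) \<and>
     (\<forall>S. finite S \<and> S \<subseteq> verts G \<longrightarrow>
        finite (infinite_components_without G S) \<and> card (infinite_components_without G S) \<le> 2)"

text \<open>A vertex \<open>(i; v\<^sub>0, \<dots>, v\<^sub>k\<^sub>-\<^sub>1)\<close> is the pair of \<open>i\<close> and the list \<open>[v\<^sub>0, \<dots>, v\<^sub>k\<^sub>-\<^sub>1]\<close>.\<close>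

definition Z_verts :: "'a pair_pre_digraph \<Rightarrow> nat \<Rightarrow> (int \<times> 'a list) set" where
  "Z_verts D k = UNIV \<times> {v. length v = k \<and> set v \<subseteq> pverts D}"

definition Z_digraph :: "'a pair_pre_digraph \<Rightarrow> nat \<Rightarrow> (int \<times> 'a list) pair_pre_digraph" where
  "Z_digraph D k = \<lparr>
     pverts = Z_verts D k,
     parcs = {((i, v), (i', w)) | i v i' w.
       (i, v) \<in> Z_verts D k \<and> (i', w) \<in> Z_verts D k \<and> i' = i + 1 \<and>
       (\<forall>j<k. if [int j = i] (mod int k) then (v ! j, w ! j) \<in> parcs D else v ! j = w ! j)}\<rparr>"

end

theory Submission
  imports Defs "HOL-Combinatorics.Permutations"
begin

text \<open>An arc from level \<open>i\<close> to level \<open>i + 1\<close> changes exactly the coordinate \<open>i mod k\<close>, so a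
  \<open>k\<close>-arc changes every coordinate exactly once and is determined by its two ends, whose
  coordinates are pairwise different. Shifting the levels, with a rotation of the coordinates,
  and permuting the symbols separately in each coordinate are automorphisms; as the symmetric
  group is 2-transitive, they move any \<open>k\<close>-arc to any other. A \<open>(k + 1)\<close>-arc changes one coordinate
  twice, and whether that coordinate returns to its initial value is invariant under
  automorphisms; both cases occur because there are at least three symbols.

  For the ends, two vertices at levels at least \<open>n\<close> have directed walks upwards to a common
  vertex, again because of the third symbol, and dually downwards. Removing a finite set
  therefore leaves all high levels in one component, all low levels in one component, and only
  finitely many other vertices; removing level 0 separates the two.\<close>

section \<open>Walks and automorphisms\<close>

text \<open>Well-formedness keeps every intermediate vertex in \<open>pverts G\<close>, the only
  place where an automorphism is known to preserve arcs.\<close>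

lemma automorphism_relpow:
  assumes "pair_wf_digraph G" "f \<in> digraph_automorphisms G" "(x, y) \<in> parcs G ^^ n"
  shows "(f x, f y) \<in> parcs G ^^ n"
  using assms(3)
proof (induction n arbitrary: y)
  case (Suc n)
  then obtain z where z: "(x, z) \<in> parcs G ^^ n" "(z, y) \<in> parcs G"
    by auto
  then have "z \<in> pverts G" "y \<in> pverts G"
    using pair_wf_digraph.wellformed'[OF assms(1)] by auto
  then have "(f z, f y) \<in> parcs G"
    using assms(2) z(2) by (auto simp: digraph_automorphisms_def)
  then show ?case
    using Suc.IH[OF z(1)] by auto
qed simp

text \<open>This is 2-transitivity of the symmetric group. One transposition sends \<open>a\<close>
  to \<open>a'\<close> and \<open>b\<close> to some \<open>e\<close>; a second one moves
  \<open>e\<close> to \<open>b'\<close> and fixes \<open>a'\<close>, as neither \<open>e\<close> nor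
  \<open>b'\<close> equals \<open>a'\<close>.\<close>

lemma permutes_two_points:
  assumes "a \<in> V" "b \<in> V" "a' \<in> V" "b' \<in> V" "a \<noteq> b" "a' \<noteq> b'"
  obtains \<pi> where "\<pi> permutes V" "\<pi> a = a'" "\<pi> b = b'"
proof
  define e where "e = transpose a a' b"
  have e: "e \<in> V" "e \<noteq> a'"
    using assms by (auto simp: e_def transpose_def)
  show "(transpose e b' \<circ> transpose a a') permutes V"
    using assms e by (intro permutes_compose permutes_swap_id)
  show "(transpose e b' \<circ> transpose a a') a = a'"
    using assms e by (simp add: transpose_def)
  show "(transpose e b' \<circ> transpose a a') b = b'"
    by (simp flip: e_def)
qed

section \<open>Components of the underlying undirected graph\<close>

lemma reachable_mk_symmetric_trans:
  assumes "x \<rightarrow>\<^sup>*\<^bsub>with_proj (mk_symmetric G)\<^esub> y" "y \<rightarrow>\<^sup>*\<^bsub>with_proj (mk_symmetric G)\<^esub> z"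
  shows "x \<rightarrow>\<^sup>*\<^bsub>with_proj (mk_symmetric G)\<^esub> z"
  using assms unfolding reachable_def by (rule rtrancl_on_trans)

lemma reachable_mk_symmetric_sym:
  assumes "x \<rightarrow>\<^sup>*\<^bsub>with_proj (mk_symmetric G)\<^esub> y"
  shows "y \<rightarrow>\<^sup>*\<^bsub>with_proj (mk_symmetric G)\<^esub> x"
proof -
  have "sym (rtrancl_on (pverts (mk_symmetric G)) (parcs (mk_symmetric G)))"
    by (rule rtrancl_on_sym) (auto simp: sym_def parcs_mk_symmetric)
  then show ?thesis
    using assms by (auto simp: reachable_def sym_def)
qed

text \<open>Components are classes of an equivalence relation, so one connection between two of them
  identifies them.\<close>

lemma components_eqI:
  assumes "C \<in> components G" "C' \<in> components G" "x \<in> C" "y \<in> C'"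
    and "x \<rightarrow>\<^sup>*\<^bsub>with_proj (mk_symmetric G)\<^esub> y"
  shows "C = C'"
proof -
  have "y \<in> C"
    using assms(1,3,5) reachable_mk_symmetric_sym[OF assms(5)]
    unfolding components_def pre_digraph.sccs_verts_def by blast
  show ?thesis
  proof (rule set_eqI)
    fix z
    show "z \<in> C \<longleftrightarrow> z \<in> C'"
      using assms(1,2,4) \<open>y \<in> C\<close>
      unfolding components_def pre_digraph.sccs_verts_def by blast
  qed
qed

lemma components_verts:
  assumes "C \<in> components G"
  shows "C \<subseteq> verts G"
proof
  fix x assume "x \<in> C"
  then have "x \<rightarrow>\<^sup>*\<^bsub>with_proj (mk_symmetric G)\<^esub> x"
    using assms by (auto simp: components_def pre_digraph.sccs_verts_def)
  then show "x \<in> verts G"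
    unfolding reachable_def by (auto dest: in_rtrancl_on_in_F)
qed

text \<open>No undirected walk leaves a set closed under adjacency, which gives the maximality
  required of a component.\<close>

lemma componentsI:
  assumes "C \<noteq> {}" "\<And>x y. x \<in> C \<Longrightarrow> y \<in> C \<Longrightarrow> x \<rightarrow>\<^sup>*\<^bsub>with_proj (mk_symmetric G)\<^esub> y"
    and closed: "\<And>x y. x \<in> C \<Longrightarrow> (x, y) \<in> parcs (mk_symmetric G) \<Longrightarrow> y \<in> C"
  shows "C \<in> components G"
proof -
  have "y \<in> C" if "x \<in> C" "x \<rightarrow>\<^sup>*\<^bsub>with_proj (mk_symmetric G)\<^esub> y" for x y
    using that(2) unfolding reachable_def
    by (induction rule: rtrancl_on_induct) (use that(1) closed in auto)
  then show ?thesis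
    using assms(1,2) unfolding components_def pre_digraph.sccs_verts_def by blast
qed

section \<open>The digraph \<open>\<int>(K\<^sub>d\<^sub>+\<^sub>1, k)\<close>\<close>

locale Z_complete_digraph =
  fixes D :: "'a pair_pre_digraph" and d k :: nat
  assumes d_ge_2: "d \<ge> 2" and k_ge_1: "k \<ge> 1"
    and complete: "complete_digraph (d + 1) (with_proj D)"
begin

abbreviation V :: "'a set" where "V \<equiv> pverts D"

abbreviation Z :: "(int \<times> 'a list) pair_pre_digraph" where "Z \<equiv> Z_digraph D k"

text \<open>The residue is a natural number so that it can index the list of a vertex; arcs leaving
  level \<open>i\<close> change this position.\<close>

definition coord :: "int \<Rightarrow> nat" where "coord i = nat (i mod int k)"

lemma V_facts: "finite V" "card V = d + 1" "parcs D = {(u, v). u \<in> V \<and> v \<in> V \<and> u \<noteq> v}"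
  using complete by (auto simp: complete_digraph_pair_def)

text \<open>Here \<open>d \<ge> 2\<close> enters: there are at least three symbols.\<close>

lemma ex_avoiding_two: "\<exists>x\<in>V. x \<noteq> a \<and> x \<noteq> b"
proof (rule ccontr)
  assume "\<not> ?thesis"
  then have "V \<subseteq> {a, b}" by auto
  then have "card V \<le> card {a, b}" by (intro card_mono) auto
  also have "\<dots> \<le> 2" by (simp add: card_insert_if)
  finally show False using V_facts(2) d_ge_2 by simp
qed

section \<open>Residues of levels modulo \<open>k\<close>\<close>

lemma coord_less [simp]: "coord i < k"
  using k_ge_1 by (simp add: coord_def nat_less_iff)

lemma int_coord: "int (coord i) = i mod int k"
  using k_ge_1 by (simp add: coord_def)

lemma coord_eq_iff: "coord i = coord i' \<longleftrightarrow> [i = i'] (mod int k)"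
  by (metis cong_def int_coord coord_def)

lemma coord_of_nat [simp]: "j < k \<Longrightarrow> coord (int j) = j"
  by (simp add: coord_def nat_mod_as_int)

lemma eq_coord_iff: "j < k \<Longrightarrow> j = coord i \<longleftrightarrow> [int j = i] (mod int k)"
  using coord_eq_iff[of "int j" i] by simp

lemma coord_coord_add: "coord (int (coord i) + s) = coord (i + s)"
  by (simp add: coord_eq_iff int_coord cong_def mod_simps)

lemma coord_coord_diff: "coord (int (coord i) - s) = coord (i - s)"
  by (simp add: coord_eq_iff int_coord cong_def mod_simps)

section \<open>Vertices and arcs in coordinates\<close>

lemma pverts_Z: "(i, v) \<in> pverts Z \<longleftrightarrow> length v = k \<and> set v \<subseteq> V"
  by (simp add: Z_digraph_def Z_verts_def)

lemma pverts_Z_length: "(i, v) \<in> pverts Z \<Longrightarrow> length v = k"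
  by (simp add: pverts_Z)

lemma list_update_in_pverts_Z:
  "(i, v) \<in> pverts Z \<Longrightarrow> a \<in> V \<Longrightarrow> (i', v[j := a]) \<in> pverts Z"
  by (auto simp: pverts_Z dest: set_update_subset_insert[THEN subsetD])

lemma nth_in_V: "(i, v) \<in> pverts Z \<Longrightarrow> j < k \<Longrightarrow> v ! j \<in> V"
  by (auto simp: pverts_Z)

lemma pverts_Z_map: "(i, map f [0..<k]) \<in> pverts Z \<longleftrightarrow> (\<forall>j<k. f j \<in> V)"
  by (auto simp: pverts_Z)

text \<open>In a complete digraph adjacency is inequality, so a single equivalence covers both the
  changed coordinate and the unchanged ones.\<close>

lemma parcs_Z:
  "((i, v), (i', w)) \<in> parcs Z \<longleftrightarrow>
     (i, v) \<in> pverts Z \<and> (i', w) \<in> pverts Z \<and> i' = i + 1 \<and>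
     (\<forall>j<k. v ! j \<noteq> w ! j \<longleftrightarrow> j = coord i)"
proof -
  have "(if [int j = i] (mod int k) then (v ! j, w ! j) \<in> parcs D else v ! j = w ! j) \<longleftrightarrow>
      (v ! j \<noteq> w ! j \<longleftrightarrow> j = coord i)"
    if "(i, v) \<in> pverts Z" "(i', w) \<in> pverts Z" "j < k" for j
    using that nth_in_V[OF that(1,3)] nth_in_V[OF that(2,3)]
    by (auto simp: eq_coord_iff V_facts(3))
  then have "(\<forall>j<k. if [int j = i] (mod int k) then (v ! j, w ! j) \<in> parcs D else v ! j = w ! j) \<longleftrightarrow>
      (\<forall>j<k. v ! j \<noteq> w ! j \<longleftrightarrow> j = coord i)"
    if "(i, v) \<in> pverts Z" "(i', w) \<in> pverts Z"
    using that by (intro all_cong) blast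
  then show ?thesis
    unfolding Z_digraph_def by (simp cong: conj_cong) blast
qed

lemma wf_Z: "pair_wf_digraph Z"
  by unfold_locales (auto simp: parcs_Z)

subsection \<open>Valencies\<close>

text \<open>Out-arcs are parametrised by the new symbol, ready for counting.\<close>

lemma parcs_Z_list_update:
  "((i, v), (i', w)) \<in> parcs Z \<longleftrightarrow>
     (i, v) \<in> pverts Z \<and> i' = i + 1 \<and> (\<exists>a\<in>V - {v ! coord i}. w = v[coord i := a])"
  (is "?L \<longleftrightarrow> ?R")
proof
  assume ?L
  then have *: "(i, v) \<in> pverts Z" "(i', w) \<in> pverts Z" "i' = i + 1"
      "\<And>j. j < k \<Longrightarrow> v ! j = w ! j \<longleftrightarrow> j \<noteq> coord i"
    by (auto simp: parcs_Z)
  then have "w ! j = v ! j" if "j < k" "coord i \<noteq> j" for j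
    using that by metis
  with * have "w = v[coord i := w ! coord i]"
    by (intro nth_equalityI) (auto simp: pverts_Z_length nth_list_update)
  moreover have "w ! coord i \<in> V - {v ! coord i}"
    using nth_in_V[OF *(2)] *(4)[of "coord i"] by (simp add: eq_commute)
  ultimately show ?R using *(1,3) by blast
next
  assume ?R
  then show ?L
    by (auto simp: parcs_Z pverts_Z_length nth_list_update
        intro: list_update_in_pverts_Z split: if_splits)
qed

text \<open>The version for in-arcs uses position \<open>coord (i - 1)\<close>, since such an arc
  starts at level \<open>i - 1\<close>.\<close>

lemma parcs_Z_list_update':
  "((i', w), (i, v)) \<in> parcs Z \<longleftrightarrow>
     (i, v) \<in> pverts Z \<and> i' = i - 1 \<and> (\<exists>a\<in>V - {v ! coord (i - 1)}. w = v[coord (i - 1) := a])"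
  (is "?L \<longleftrightarrow> ?R")
proof
  assume ?L
  then have *: "(i, v) \<in> pverts Z" "(i', w) \<in> pverts Z" "i' = i - 1"
      "\<And>j. j < k \<Longrightarrow> v ! j = w ! j \<longleftrightarrow> j \<noteq> coord (i - 1)"
    by (auto simp: parcs_Z)
  then have "w ! j = v ! j" if "j < k" "coord (i - 1) \<noteq> j" for j
    using that by metis
  with * have "w = v[coord (i - 1) := w ! coord (i - 1)]"
    by (intro nth_equalityI) (auto simp: pverts_Z_length nth_list_update)
  moreover have "w ! coord (i - 1) \<in> V - {v ! coord (i - 1)}"
    using nth_in_V[OF *(2)] *(4)[of "coord (i - 1)"] by (simp add: eq_commute)
  ultimately show ?R using *(1,3) by blast
next
  assume ?R
  then show ?L
    by (auto simp: parcs_Z pverts_Z_length nth_list_update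
        intro: list_update_in_pverts_Z split: if_splits)
qed

lemma card_V_minus: "j < k \<Longrightarrow> (i, v) \<in> pverts Z \<Longrightarrow> card (V - {v ! j}) = d"
  using V_facts nth_in_V by (simp add: card_Diff_singleton)

lemma list_update_inj: "j < length v \<Longrightarrow> v[j := a] = v[j := b] \<Longrightarrow> a = b"
  by (metis nth_list_update_eq)

lemma out_degree_Z:
  assumes "x \<in> pverts Z"
  shows "out_degree (with_proj Z) x = d"
proof -
  obtain i v where x: "x = (i, v)" by (cases x)
  have "out_arcs (with_proj Z) x = (\<lambda>a. ((i, v), (i + 1, v[coord i := a]))) ` (V - {v ! coord i})"
    using assms by (auto simp: out_arcs_def x parcs_Z_list_update)
  moreover have "inj_on (\<lambda>a. ((i, v), (i + 1, v[coord i := a]))) (V - {v ! coord i})"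
    using assms by (auto intro!: inj_onI dest!: list_update_inj[rotated] simp: x pverts_Z_length)
  ultimately show ?thesis
    using assms by (simp add: out_degree_def card_image card_V_minus x)
qed

lemma in_degree_Z:
  assumes "x \<in> pverts Z"
  shows "in_degree (with_proj Z) x = d"
proof -
  obtain i v where x: "x = (i, v)" by (cases x)
  let ?j = "coord (i - 1)"
  have "in_arcs (with_proj Z) x = (\<lambda>a. ((i - 1, v[?j := a]), (i, v))) ` (V - {v ! ?j})"
    using assms by (auto simp: in_arcs_def x parcs_Z_list_update')
  moreover have "inj_on (\<lambda>a. ((i - 1, v[?j := a]), (i, v))) (V - {v ! ?j})"
    using assms by (auto intro!: inj_onI dest!: list_update_inj[rotated] simp: x pverts_Z_length)
  ultimately show ?thesis
    using assms by (simp add: in_degree_def card_image card_V_minus x)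
qed

subsection \<open>Walks of length \<open>k\<close>\<close>

text \<open>Along a walk of length \<open>k\<close> starting at level \<open>i\<close>, coordinate \<open>j\<close> changes in
  step number \<open>change_time i j\<close> only, counting steps from 0.\<close>

definition change_time :: "int \<Rightarrow> nat \<Rightarrow> nat" where
  "change_time i j = coord (int j - i)"

lemma change_time_less [simp]: "change_time i j < k"
  by (simp add: change_time_def)

text \<open>Positions and step numbers correspond bijectively: step \<open>t\<close> starts at level
  \<open>i + t\<close> and changes the position of that residue.\<close>

lemma change_time_eq_iff:
  assumes "j < k" "t < k"
  shows "change_time i j = t \<longleftrightarrow> j = coord (i + int t)"
proof -
  have "change_time i j = t \<longleftrightarrow> [int t = int j - i] (mod int k)"
    using eq_coord_iff[OF assms(2), of "int j - i"] by (simp add: change_time_def eq_commute)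
  also have "\<dots> \<longleftrightarrow> [int j = i + int t] (mod int k)"
    by (auto simp: cong_iff_dvd_diff algebra_simps dvd_diff_commute)
  finally show ?thesis
    using eq_coord_iff[OF assms(1)] by simp
qed

lemma walk_level:
  assumes "\<And>t. t < n \<Longrightarrow> (P t, P (Suc t)) \<in> parcs Z" "t \<le> n"
  shows "fst (P t) = fst (P 0) + int t"
  using assms(2)
proof (induction t)
  case (Suc t)
  then have "fst (P (Suc t)) = fst (P t) + 1"
    using assms(1)[of t] by (cases "P t"; cases "P (Suc t)") (auto simp: parcs_Z)
  then show ?case using Suc by simp
qed simp

lemma walk_step:
  assumes "\<And>t. t < k \<Longrightarrow> (P t, P (Suc t)) \<in> parcs Z" "t < k" "j < k"
  shows "snd (P t) ! j \<noteq> snd (P (Suc t)) ! j \<longleftrightarrow> change_time (fst (P 0)) j = t"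
proof -
  have "snd (P t) ! j \<noteq> snd (P (Suc t)) ! j \<longleftrightarrow> j = coord (fst (P t))"
    using assms(1)[OF assms(2)] assms(3)
    by (cases "P t"; cases "P (Suc t)") (simp add: parcs_Z)
  then show ?thesis
    using walk_level[of k P t] assms by (simp add: change_time_eq_iff)
qed

text \<open>As a coordinate changes only once, it keeps its initial value up to that step and has
  its final value afterwards. Hence the two ends determine the walk.\<close>

lemma walk_coordinates:
  assumes walk: "\<And>t. t < k \<Longrightarrow> (P t, P (Suc t)) \<in> parcs Z" and j: "j < k" and t: "t \<le> k"
  shows "snd (P t) ! j =
      (if t \<le> change_time (fst (P 0)) j then snd (P 0) ! j else snd (P k) ! j)"
    (is "_ = (if t \<le> ?T then _ else _)")
proof (cases "t \<le> ?T")
  case True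
  then have "snd (P t) ! j = snd (P 0) ! j"
    using t
  proof (induction t)
    case (Suc t)
    then show ?case using walk_step[of P t j] walk j by auto
  qed simp
  then show ?thesis using True by simp
next
  case False
  \<comment> \<open>After the change, the induction runs backwards from \<open>k\<close>.\<close>
  have "snd (P t) ! j = snd (P k) ! j"
    using t False
  proof (induction t rule: inc_induct)
    case (step t)
    then show ?case using walk_step[of P t j] walk j by auto
  qed simp
  then show ?thesis using False by simp
qed

lemma walk_ends_differ:
  assumes "\<And>t. t < k \<Longrightarrow> (P t, P (Suc t)) \<in> parcs Z" "j < k"
  shows "snd (P 0) ! j \<noteq> snd (P k) ! j"
proof -
  let ?T = "change_time (fst (P 0)) j"
  have "snd (P ?T) ! j \<noteq> snd (P (Suc ?T)) ! j"
    using walk_step[of P ?T j] assms by simp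
  then show ?thesis
    using walk_coordinates[of P j ?T] walk_coordinates[of P j "Suc ?T"] assms
    by (simp add: Suc_le_eq less_imp_le)
qed

text \<open>Conversely to \<open>walk_ends_differ\<close>, overwriting the coordinates of
  \<open>v\<close> by those of \<open>w\<close> in the order of their change times gives a
  walk.\<close>

lemma relpow_k_iff:
  assumes "(i, v) \<in> pverts Z" "(i', w) \<in> pverts Z"
  shows "((i, v), (i', w)) \<in> parcs Z ^^ k \<longleftrightarrow> i' = i + int k \<and> (\<forall>j<k. v ! j \<noteq> w ! j)"
    (is "?L \<longleftrightarrow> ?R")
proof
  assume ?L
  then obtain P where "P 0 = (i, v)" "P k = (i', w)" "\<And>t. t < k \<Longrightarrow> (P t, P (Suc t)) \<in> parcs Z"
    by (auto simp: relpow_fun_conv)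
  then show ?R
    using walk_ends_differ[of P] walk_level[of k P k] by auto
next
  assume R: ?R
  define P where
    "P t = (i + int t, map (\<lambda>j. if change_time i j < t then w ! j else v ! j) [0..<k])" for t
  have "(P t, P (Suc t)) \<in> parcs Z" if "t < k" for t
  proof -
    have "P t \<in> pverts Z" for t
      using nth_in_V[OF assms(1)] nth_in_V[OF assms(2)] by (simp add: P_def pverts_Z_map)
    note this[of t] this[of "Suc t"]
    moreover have "(if change_time i j < t then w ! j else v ! j) \<noteq>
        (if change_time i j < Suc t then w ! j else v ! j) \<longleftrightarrow> j = coord (i + int t)"
      if "j < k" for j
      using R that unfolding change_time_eq_iff[OF that \<open>t < k\<close>, symmetric]
      by (auto simp: less_Suc_eq)
    ultimately show ?thesis
      by (simp add: P_def parcs_Z split del: if_split cong: if_cong)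
  qed
  moreover have "P 0 = (i, v)"
    using assms by (auto simp: P_def pverts_Z_length intro!: nth_equalityI)
  moreover have "P k = (i', w)"
    using assms R by (auto simp: P_def pverts_Z_length intro!: nth_equalityI)
  ultimately show ?L
    by (auto simp: relpow_fun_conv)
qed

subsection \<open>Arc-transitivity\<close>

text \<open>Shifting levels by \<open>s\<close> moves the coordinate that changes by
  \<open>s\<close> as well, so position \<open>j\<close> is filled from position
  \<open>j - s\<close> modulo \<open>k\<close>.\<close>

definition shift_permute :: "int \<Rightarrow> (nat \<Rightarrow> 'a \<Rightarrow> 'a) \<Rightarrow> int \<times> 'a list \<Rightarrow> int \<times> 'a list" where
  "shift_permute s \<pi> = (\<lambda>(i, v). (i + s, map (\<lambda>j. \<pi> j (v ! coord (int j - s))) [0..<k]))"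

lemma shift_permute_in_verts:
  assumes "\<And>j. j < k \<Longrightarrow> \<pi> j permutes V" "x \<in> pverts Z"
  shows "shift_permute s \<pi> x \<in> pverts Z"
  using assms nth_in_V
  by (cases x) (auto simp: shift_permute_def pverts_Z_map permutes_in_image)

lemma shift_permute_automorphism:
  assumes \<pi>: "\<And>j. j < k \<Longrightarrow> \<pi> j permutes V"
  shows "shift_permute s \<pi> \<in> digraph_automorphisms Z"
proof -
  \<comment> \<open>Old position \<open>j\<close> was moved to \<open>coord (j + s)\<close>, so the
    inverse map must undo the permutation used there.\<close>
  define \<rho> where "\<rho> j = inv (\<pi> (coord (int j + s)))" for j
  have \<rho>: "\<rho> j permutes V" for j
    using \<pi> by (simp add: \<rho>_def permutes_inv)
  have "bij_betw (shift_permute s \<pi>) (pverts Z) (pverts Z)"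
  proof (rule bij_betw_byWitness[where f' = "shift_permute (- s) \<rho>"])
    show "\<forall>x\<in>pverts Z. shift_permute (- s) \<rho> (shift_permute s \<pi> x) = x"
      using \<pi> by (auto simp: shift_permute_def pverts_Z_length coord_coord_diff
          \<rho>_def permutes_inverses[of _ V]
          intro!: nth_equalityI)
    show "\<forall>x\<in>pverts Z. shift_permute s \<pi> (shift_permute (- s) \<rho> x) = x"
      using \<pi> by (auto simp: shift_permute_def pverts_Z_length coord_coord_add
          \<rho>_def permutes_inverses[of _ V]
          intro!: nth_equalityI)
  qed (use \<pi> \<rho> shift_permute_in_verts in auto)
  moreover have "(x, y) \<in> parcs Z \<longleftrightarrow> (shift_permute s \<pi> x, shift_permute s \<pi> y) \<in> parcs Z"
    if xy: "x \<in> pverts Z" "y \<in> pverts Z" for x y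
  proof -
    obtain i v i' w where x: "x = (i, v)" and y: "y = (i', w)" by (cases x, cases y)
    have *: "j = coord (i + s) \<longleftrightarrow> coord (int j - s) = coord i" if "j < k" for j
      using that by (auto simp: eq_coord_iff coord_eq_iff cong_iff_dvd_diff algebra_simps)
    have inj: "\<pi> j a = \<pi> j b \<longleftrightarrow> a = b" if "j < k" for j a b
      using \<pi>[OF that] by (metis permutes_inverses(2))
    have "(\<forall>j<k. v ! j \<noteq> w ! j \<longleftrightarrow> j = coord i) \<longleftrightarrow>
        (\<forall>j<k. v ! coord (int j - s) \<noteq> w ! coord (int j - s) \<longleftrightarrow> coord (int j - s) = coord i)"
      (is "?A \<longleftrightarrow> ?B")
    proof
      assume B: ?B
      show ?A
      proof (intro allI impI)
        \<comment> \<open>The rotation of positions is onto: \<open>coord (j + s)\<close> is sent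
          back to \<open>j\<close>.\<close>
        fix j assume "j < k"
        then have "coord (int (coord (int j + s)) - s) = j"
          by (simp add: coord_coord_diff)
        then show "v ! j \<noteq> w ! j \<longleftrightarrow> j = coord i"
          using B[rule_format, of "coord (int j + s)"] by simp
      qed
    qed auto
    then show ?thesis
      using xy shift_permute_in_verts[where s = s, OF \<pi> xy(1)]
        shift_permute_in_verts[where s = s, OF \<pi> xy(2)]
      by (auto simp: parcs_Z x y shift_permute_def inj *)
  qed
  ultimately show ?thesis
    by (auto simp: digraph_automorphisms_def)
qed

lemma k_arcs_walk: "p \<in> k_arcs Z n \<Longrightarrow> t < n \<Longrightarrow> (p ! t, p ! Suc t) \<in> parcs Z"
  by (auto simp: k_arcs_def dest: bspec[of _ _ "Suc t"])

text \<open>A \<open>k\<close>-arc is determined by its initial level and the two values of each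
  coordinate. A shift matches the levels, and 2-transitivity matches the pairs of values.\<close>

lemma k_arc_transitive_Z: "k_arc_transitive Z k"
  unfolding k_arc_transitive_def
proof (intro ballI)
  fix p q assume p: "p \<in> k_arcs Z k" and q: "q \<in> k_arcs Z k"
  define i i' s where "i = fst (p ! 0)" and "i' = fst (q ! 0)" and "s = i' - i"
  have len: "length p = Suc k" "length q = Suc k"
    using p q by (auto simp: k_arcs_def)
  have verts: "p ! t \<in> pverts Z" "q ! t \<in> pverts Z" if "t \<le> k" for t
    using p q that nth_mem[of t p] nth_mem[of t q] by (auto simp: k_arcs_def)
  have in_V: "snd (p ! t) ! j \<in> V" "snd (q ! t) ! j \<in> V" if "t \<le> k" "j < k" for t j
    using verts[OF that(1)] nth_in_V[of _ _ j] that(2) by (metis prod.collapse)+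
  have coords:
    "snd (p ! t) ! j = (if t \<le> change_time i j then snd (p ! 0) ! j else snd (p ! k) ! j)"
    "snd (q ! t) ! j = (if t \<le> change_time i' j then snd (q ! 0) ! j else snd (q ! k) ! j)"
    if "j < k" "t \<le> k" for j t
    using walk_coordinates[of "(!) p" j t] walk_coordinates[of "(!) q" j t]
      k_arcs_walk[OF p] k_arcs_walk[OF q] that
    by (simp_all add: i_def i'_def)
  have differ: "snd (p ! 0) ! j \<noteq> snd (p ! k) ! j" "snd (q ! 0) ! j \<noteq> snd (q ! k) ! j"
    if "j < k" for j
    using walk_ends_differ[of "(!) p" j] walk_ends_differ[of "(!) q" j]
      k_arcs_walk[OF p] k_arcs_walk[OF q] that
    by simp_all
  have "\<exists>\<pi>. \<pi> permutes V \<and> \<pi> (snd (p ! 0) ! coord (int j - s)) = snd (q ! 0) ! j \<and>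
      \<pi> (snd (p ! k) ! coord (int j - s)) = snd (q ! k) ! j" if "j < k" for j
    using in_V[OF _ that] in_V[of _ "coord (int j - s)"] differ(1)[of "coord (int j - s)"]
      differ(2)[OF that]
    by (metis permutes_two_points coord_less le_refl zero_le)
  then obtain \<pi> where \<pi>: "\<And>j. j < k \<Longrightarrow> \<pi> j permutes V"
    "\<And>j. j < k \<Longrightarrow> \<pi> j (snd (p ! 0) ! coord (int j - s)) = snd (q ! 0) ! j"
    "\<And>j. j < k \<Longrightarrow> \<pi> j (snd (p ! k) ! coord (int j - s)) = snd (q ! k) ! j"
    by metis
  have "shift_permute s \<pi> (p ! t) = q ! t" if t: "t \<le> k" for t
  proof (rule prod_eqI)
    show "fst (shift_permute s \<pi> (p ! t)) = fst (q ! t)"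
      using walk_level[of k "(!) p" t] walk_level[of k "(!) q" t]
        k_arcs_walk[OF p] k_arcs_walk[OF q] t
      by (simp add: shift_permute_def split_beta s_def i_def i'_def)
    \<comment> \<open>The rotation preserves change times, so corresponding coordinates switch at
      the same step.\<close>
    have time: "change_time i (coord (int j - s)) = change_time i' j" if "j < k" for j
      by (simp add: change_time_def s_def coord_coord_diff)
    have "length (snd (q ! t)) = k"
      using verts[OF t] by (metis prod.collapse pverts_Z)
    moreover have "\<pi> j (snd (p ! t) ! coord (int j - s)) = snd (q ! t) ! j" if "j < k" for j
      using coords(1)[OF coord_less t, of "int j - s"] coords(2)[OF that t] \<pi>(2,3)[OF that]
        time[OF that]
      by (simp flip: i_def i'_def)
    ultimately show "snd (shift_permute s \<pi> (p ! t)) = snd (q ! t)"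
      by (auto simp: shift_permute_def split_beta intro!: nth_equalityI)
  qed
  then have "map (shift_permute s \<pi>) p = q"
    using len by (auto intro!: nth_equalityI)
  then show "\<exists>f\<in>digraph_automorphisms Z. map f p = q"
    using shift_permute_automorphism[of \<pi> s] \<pi>(1) by blast
qed

text \<open>In a \<open>(k + 1)\<close>-arc the first coordinate to change is changed once more in the last step.
  It returns to its initial value iff every out-neighbour of the initial vertex is joined
  to the final vertex by a walk of length \<open>k\<close>, a property that automorphisms preserve.\<close>

lemma not_Suc_k_arc_transitive_Z: "\<not> k_arc_transitive Z (k + 1)"
proof
  assume trans: "k_arc_transitive Z (k + 1)"
  obtain a b c where abc: "a \<in> V" "b \<in> V" "c \<in> V" "b \<noteq> a" "c \<noteq> a" "c \<noteq> b"
    using ex_avoiding_two by metis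
  \<comment> \<open>From the constant list \<open>a\<close>, the positions
    \<open>0, ..., k - 1\<close> become \<open>b\<close> in turn; the last step changes position 0
    from \<open>b\<close> to \<open>x\<close>. It returns to its initial value for
    \<open>x = a\<close> but not for \<open>x = c\<close>.\<close>
  define P where "P x t =
      (int t, map (\<lambda>j. if j = 0 \<and> t = Suc k then x else if j < t then b else a) [0..<k])" for x t
  define p where "p x = map (P x) [0..<k + 2]" for x
  have arc: "(P x t, P x (Suc t)) \<in> parcs Z" if "x \<in> V" "x \<noteq> b" "t < k + 1" for x t
  proof (cases "t = k")
    case True
    then have "coord (int t) = 0" by (simp add: coord_def)
    then show ?thesis
      using that True abc k_ge_1 by (auto simp: P_def parcs_Z pverts_Z_map)
  next
    case False
    then have "coord (int t) = t" using that by simp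
    then show ?thesis
      using that False abc by (auto simp: P_def parcs_Z pverts_Z_map)
  qed
  have p: "p x \<in> k_arcs Z (k + 1)" if "x \<in> V" "x \<noteq> b" for x
  proof -
    have "(P x (t - 1), P x t) \<in> parcs Z" if "t \<in> {1..k + 1}" for t
      using arc[OF \<open>x \<in> V\<close> \<open>x \<noteq> b\<close>, of "t - 1"] that by auto
    moreover have "P x t \<in> pverts Z" for t
      using that abc by (auto simp: P_def pverts_Z_map)
    ultimately show ?thesis
      by (auto simp: k_arcs_def p_def simp del: upt_Suc)
  qed
  then obtain f where f: "f \<in> digraph_automorphisms Z" "map f (p a) = p c"
    using trans abc unfolding k_arc_transitive_def by blast
  have f_P: "f (P a t) = P c t" if "t < k + 2" for t
    using arg_cong[OF f(2), of "\<lambda>l. l ! t"] that by (simp add: p_def del: upt_Suc)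
  \<comment> \<open>This out-neighbour of the initial vertex agrees with the end of
    \<open>p c\<close> in position 0, so no walk of length \<open>k\<close> joins them.\<close>
  define y where "y = (1 :: int, (replicate k a)[0 := c])"
  have y: "y \<in> pverts Z"
    using abc by (auto simp: y_def pverts_Z dest: set_update_subset_insert[THEN subsetD])
  have P_0: "P x 0 = (0, replicate k a)" for x
    by (auto simp: P_def intro!: nth_equalityI)
  have "(P c 0, y) \<in> parcs Z"
  proof -
    have "coord 0 = 0" by (simp add: coord_def)
    then show ?thesis
      using abc y k_ge_1 by (auto simp: P_0 y_def parcs_Z pverts_Z nth_list_update)
  qed
  \<comment> \<open>The preimage \<open>x\<close> of \<open>y\<close> is again an out-neighbour of
    the common initial vertex. It differs from the end of \<open>p a\<close> everywhere: in position
    0 from \<open>a\<close>, elsewhere \<open>a\<close> from \<open>b\<close>.\<close>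
  have "f ` pverts Z = pverts Z"
    using f(1) by (simp add: digraph_automorphisms_def bij_betw_def)
  then obtain x where x: "x \<in> pverts Z" "f x = y"
    using y by (metis imageE)
  have "P a 0 \<in> pverts Z"
    using abc by (auto simp: P_0 pverts_Z)
  then have "(P a 0, x) \<in> parcs Z"
    using \<open>(P c 0, y) \<in> parcs Z\<close> f(1) x f_P[of 0]
    by (auto simp: digraph_automorphisms_def)
  moreover obtain i v where iv: "x = (i, v)" by (cases x)
  ultimately have "i = 1" and v: "\<forall>j<k. a \<noteq> v ! j \<longleftrightarrow> j = 0"
    by (auto simp: P_0 parcs_Z coord_def)
  have verts: "P x' (Suc k) \<in> pverts Z" if "x' \<in> V" for x'
    using abc that by (auto simp: P_def pverts_Z_map)
  have "(x, P a (Suc k)) \<in> parcs Z ^^ k"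
    using x(1) verts[OF abc(1)] v \<open>i = 1\<close> abc
    unfolding iv P_def by (subst relpow_k_iff) auto
  then have "(y, P c (Suc k)) \<in> parcs Z ^^ k"
    using automorphism_relpow[OF wf_Z f(1)] x(2) f_P[of "Suc k"] by fastforce
  then show False
    using y verts[OF abc(3)] k_ge_1 unfolding y_def P_def by (subst (asm) relpow_k_iff) auto
qed

subsection \<open>Ends\<close>

abbreviation linked :: "(int \<times> 'a list) set \<Rightarrow> int \<times> 'a list \<Rightarrow> int \<times> 'a list \<Rightarrow> bool" where
  "linked A x y \<equiv> x \<rightarrow>\<^sup>*\<^bsub>with_proj (mk_symmetric (with_proj Z \<restriction> A))\<^esub> y"

lemma parcs_symmetric_restrict:
  "(x, y) \<in> parcs (mk_symmetric (with_proj Z \<restriction> A)) \<longleftrightarrow>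
     x \<in> A \<and> y \<in> A \<and> ((x, y) \<in> parcs Z \<or> (y, x) \<in> parcs Z)"
  by (cases x; cases y) (force simp: parcs_mk_symmetric induce_subgraph_def)

lemma linked_refl: "x \<in> A \<Longrightarrow> linked A x x"
  by (simp add: reachable_def)

lemma linked_arc: "x \<in> A \<Longrightarrow> y \<in> A \<Longrightarrow> (x, y) \<in> parcs Z \<Longrightarrow> linked A x y"
  unfolding reachable_def
  by (rule rtrancl_on_into_rtrancl_on[OF rtrancl_on_refl])
    (auto simp: parcs_symmetric_restrict)

lemma relpow_level: "(x, y) \<in> parcs Z ^^ n \<Longrightarrow> fst y = fst x + int n"
  using walk_level[of n _ n] by (auto simp: relpow_fun_conv)

text \<open>Levels increase along directed walks, so only the levels between the two ends must lie
  in \<open>A\<close>.\<close>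

lemma linked_relpow:
  assumes "(x, y) \<in> parcs Z ^^ n" "x \<in> pverts Z"
    and "{z \<in> pverts Z. fst x \<le> fst z \<and> fst z \<le> fst y} \<subseteq> A"
  shows "linked A x y"
  using assms(1,3)
proof (induction n arbitrary: y)
  case 0
  then show ?case using assms(2) by (auto intro!: linked_refl)
next
  case (Suc n)
  then obtain z where z: "(x, z) \<in> parcs Z ^^ n" "(z, y) \<in> parcs Z" by auto
  have *: "z \<in> pverts Z" "y \<in> pverts Z" "fst y = fst z + 1"
    using z(2) by (cases z; cases y; auto simp: parcs_Z)+
  have "linked A x z"
    using * Suc.prems(2) by (intro Suc.IH[OF z(1)]) auto
  moreover have "linked A z y"
    using * Suc.prems(2) relpow_level[OF z(1)] z(2) by (intro linked_arc) auto
  ultimately show ?case by (rule reachable_mk_symmetric_trans)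
qed

lemma ex_walk_up:
  assumes "x \<in> pverts Z"
  shows "\<exists>y\<in>pverts Z. (x, y) \<in> parcs Z ^^ n"
proof (induction n)
  case 0
  then show ?case using assms by auto
next
  case (Suc n)
  then obtain i v where iv: "(i, v) \<in> pverts Z" "(x, (i, v)) \<in> parcs Z ^^ n" by auto
  obtain a where "a \<in> V" "a \<noteq> v ! coord i" using ex_avoiding_two by blast
  then have "((i, v), (i + 1, v[coord i := a])) \<in> parcs Z"
    using iv(1) by (auto simp: parcs_Z_list_update)
  then show ?case
    using iv(2) pair_wf_digraph.in_arcsD2[OF wf_Z] by (meson relpow_Suc_I)
qed

lemma ex_walk_down:
  assumes "x \<in> pverts Z"
  shows "\<exists>y\<in>pverts Z. (y, x) \<in> parcs Z ^^ n"
proof (induction n)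
  case 0
  then show ?case using assms by auto
next
  case (Suc n)
  then obtain i v where iv: "(i, v) \<in> pverts Z" "((i, v), x) \<in> parcs Z ^^ n" by auto
  obtain a where "a \<in> V" "a \<noteq> v ! coord (i - 1)" using ex_avoiding_two by blast
  then have "((i - 1, v[coord (i - 1) := a]), (i, v)) \<in> parcs Z"
    using iv(1) by (auto simp: parcs_Z_list_update')
  then show ?case
    using iv(2) pair_wf_digraph.in_arcsD1[OF wf_Z] by (meson relpow_Suc_I2)
qed

text \<open>A third symbol in every coordinate makes \<open>u\<close> the list of a common end of
  walks of length \<open>k\<close>, by \<open>relpow_k_iff\<close>.\<close>

lemma ex_differing_list:
  assumes "(i, v) \<in> pverts Z" "(i', w) \<in> pverts Z"
  obtains u where "\<And>l. (l, u) \<in> pverts Z" "\<And>j. j < k \<Longrightarrow> u ! j \<noteq> v ! j \<and> u ! j \<noteq> w ! j"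
proof -
  have "\<forall>j. \<exists>a. a \<in> V \<and> a \<noteq> v ! j \<and> a \<noteq> w ! j"
    using ex_avoiding_two by blast
  then obtain g where g: "\<And>j. g j \<in> V \<and> g j \<noteq> v ! j \<and> g j \<noteq> w ! j"
    by metis
  show ?thesis
    by (rule that[of "map g [0..<k]"]) (use g in \<open>auto simp: pverts_Z_map\<close>)
qed

text \<open>Both vertices are first raised to the larger of their levels; from there, walks of
  length \<open>k\<close> lead to a common vertex. Nothing goes below level
  \<open>n\<close>.\<close>

lemma linked_above:
  assumes x: "x \<in> pverts Z" "n \<le> fst x" and y: "y \<in> pverts Z" "n \<le> fst y"
    and A: "{z \<in> pverts Z. n \<le> fst z} \<subseteq> A"
  shows "linked A x y"
proof -
  have "\<exists>x'\<in>pverts Z. fst x' = max (fst x) (fst y) \<and> linked A z x'"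
    if z: "z \<in> pverts Z" "n \<le> fst z" "fst z \<le> max (fst x) (fst y)" for z
  proof -
    let ?n = "nat (max (fst x) (fst y) - fst z)"
    obtain x' where x': "x' \<in> pverts Z" "(z, x') \<in> parcs Z ^^ ?n"
      using ex_walk_up[OF z(1)] by blast
    moreover have "linked A z x'"
      using x'(2) z A by (intro linked_relpow) auto
    ultimately show ?thesis using relpow_level[OF x'(2)] z(3) by auto
  qed
  then obtain x' y' where
    x': "x' \<in> pverts Z" "fst x' = max (fst x) (fst y)" "linked A x x'" and
    y': "y' \<in> pverts Z" "fst y' = max (fst x) (fst y)" "linked A y y'"
    using x y by (metis max.cobounded1 max.cobounded2)
  obtain v w where vw: "x' = (max (fst x) (fst y), v)" "y' = (max (fst x) (fst y), w)"
    using x'(2) y'(2) by (metis prod.collapse)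
  obtain u where u: "\<And>l. (l, u) \<in> pverts Z" "\<And>j. j < k \<Longrightarrow> u ! j \<noteq> v ! j \<and> u ! j \<noteq> w ! j"
    using ex_differing_list x'(1) y'(1) vw by metis
  define z where "z = (max (fst x) (fst y) + int k, u)"
  have "(x', z) \<in> parcs Z ^^ k" "(y', z) \<in> parcs Z ^^ k"
    using x'(1) y'(1) u by (auto simp: vw z_def relpow_k_iff eq_commute)
  then have "linked A x' z" "linked A y' z"
    using x' y' x A by (auto intro!: linked_relpow)
  then show ?thesis
    using x'(3) y'(3) by (meson reachable_mk_symmetric_trans reachable_mk_symmetric_sym)
qed

text \<open>The mirror image: walks are followed backwards to a common starting vertex.\<close>

lemma linked_below:
  assumes x: "x \<in> pverts Z" "fst x \<le> n" and y: "y \<in> pverts Z" "fst y \<le> n"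
    and A: "{z \<in> pverts Z. fst z \<le> n} \<subseteq> A"
  shows "linked A x y"
proof -
  have "\<exists>x'\<in>pverts Z. fst x' = min (fst x) (fst y) \<and> linked A x' z"
    if z: "z \<in> pverts Z" "fst z \<le> n" "min (fst x) (fst y) \<le> fst z" for z
  proof -
    let ?n = "nat (fst z - min (fst x) (fst y))"
    obtain x' where x': "x' \<in> pverts Z" "(x', z) \<in> parcs Z ^^ ?n"
      using ex_walk_down[OF z(1)] by blast
    moreover have "linked A x' z"
      using x' z A by (intro linked_relpow) auto
    ultimately show ?thesis using relpow_level[OF x'(2)] z(3) by auto
  qed
  then obtain x' y' where
    x': "x' \<in> pverts Z" "fst x' = min (fst x) (fst y)" "linked A x' x" and
    y': "y' \<in> pverts Z" "fst y' = min (fst x) (fst y)" "linked A y' y"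
    using x y by (metis min.cobounded1 min.cobounded2)
  obtain v w where vw: "x' = (min (fst x) (fst y), v)" "y' = (min (fst x) (fst y), w)"
    using x'(2) y'(2) by (metis prod.collapse)
  obtain u where u: "\<And>l. (l, u) \<in> pverts Z" "\<And>j. j < k \<Longrightarrow> u ! j \<noteq> v ! j \<and> u ! j \<noteq> w ! j"
    using ex_differing_list x'(1) y'(1) vw by metis
  define z where "z = (min (fst x) (fst y) - int k, u)"
  have "(z, x') \<in> parcs Z ^^ k" "(z, y') \<in> parcs Z ^^ k"
    using x'(1) y'(1) u by (auto simp: vw z_def relpow_k_iff)
  then have "linked A z x'" "linked A z y'"
    using x' y' x A u(1) by (auto intro!: linked_relpow simp: z_def)
  then show ?thesis
    using x'(3) y'(3) by (meson reachable_mk_symmetric_trans reachable_mk_symmetric_sym)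
qed

section \<open>Components after removing finitely many vertices\<close>

lemma ex_vertex_at_level: "\<exists>x\<in>pverts Z. fst x = i"
proof -
  obtain a where "a \<in> V" using ex_avoiding_two by blast
  then have "(i, replicate k a) \<in> pverts Z" by (auto simp: pverts_Z)
  then show ?thesis by force
qed

lemma finite_levels: "finite {x \<in> pverts Z. m \<le> fst x \<and> fst x \<le> n}"
proof (rule finite_subset)
  show "{x \<in> pverts Z. m \<le> fst x \<and> fst x \<le> n} \<subseteq> {m..n} \<times> {v. set v \<subseteq> V \<and> length v = k}"
    by (auto simp: pverts_Z)
  show "finite ({m..n} \<times> {v. set v \<subseteq> V \<and> length v = k})"
    using V_facts(1) by (simp add: finite_lists_length_eq)
qed

lemma connected_Z: "connected (with_proj Z)"
proof -
  have eq: "with_proj Z \<restriction> pverts Z = with_proj Z"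
    using pair_wf_digraph.wellformed'[OF wf_Z]
    by (auto simp: induce_subgraph_def with_proj_def)
  \<comment> \<open>The smaller of the two levels serves as the lower bound.\<close>
  have "linked (pverts Z) x y" if "x \<in> pverts Z" "y \<in> pverts Z" for x y
    using that by (intro linked_above[of x "min (fst x) (fst y)"]) auto
  then show ?thesis
    using ex_vertex_at_level by (auto simp: connected_def strongly_connected_def eq)
qed

text \<open>All levels of large absolute value avoid \<open>S\<close>. The finitely many vertices
  between them cannot hold an infinite component, so each one meets \<open>U\<close> or
  \<open>L\<close>, and each of these sets meets at most one component.\<close>

lemma infinite_components_bound:
  assumes "finite S"
  shows "finite (infinite_components_without (with_proj Z) S) \<and>
    card (infinite_components_without (with_proj Z) S) \<le> 2"
proof -
  let ?A = "pverts Z - S" and ?X = "infinite_components_without (with_proj Z) S"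
  \<comment> \<open>Inserting 0 makes the maximum meaningful for empty \<open>S\<close>; adding 1
    makes the bound strict.\<close>
  define N where "N = Max (insert 0 ((\<lambda>x. \<bar>fst x\<bar>) ` S)) + 1"
  have N: "\<bar>fst x\<bar> < N" if "x \<in> S" for x
    using assms that Max_ge[of "insert 0 ((\<lambda>x. \<bar>fst x\<bar>) ` S)" "\<bar>fst x\<bar>"]
    by (force simp: N_def)
  define U where "U = {x \<in> pverts Z. N \<le> fst x}"
  define L where "L = {x \<in> pverts Z. fst x \<le> - N}"
  have sub: "U \<subseteq> ?A" "L \<subseteq> ?A"
    using N by (force simp: U_def L_def)+
  have meets: "C \<inter> U \<noteq> {} \<or> C \<inter> L \<noteq> {}" if "C \<in> ?X" for C
  proof (rule ccontr)
    assume "\<not> ?thesis"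
    moreover have "C \<subseteq> pverts Z"
      using that components_verts[of C "with_proj Z \<restriction> ?A"]
      by (auto simp: infinite_components_without_def)
    ultimately have "C \<subseteq> {x \<in> pverts Z. - N \<le> fst x \<and> fst x \<le> N}"
      by (force simp: U_def L_def)
    then have "finite C" using finite_levels finite_subset by blast
    then show False using that by (simp add: infinite_components_without_def)
  qed
  have "C = C'" if C: "C \<in> ?X" "C' \<in> ?X" "C \<inter> U \<noteq> {}" "C' \<inter> U \<noteq> {}" for C C'
  proof -
    obtain x y where "x \<in> C" "x \<in> U" "y \<in> C'" "y \<in> U"
      using C(3,4) by blast
    moreover from this have "linked ?A x y"
      using sub by (intro linked_above[of x N y]) (auto simp: U_def)
    ultimately show ?thesis
      using C(1,2) by (intro components_eqI[of C _ C' x y])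
        (simp_all add: infinite_components_without_def)
  qed
  \<comment> \<open>If no infinite component meets \<open>U\<close>, then \<open>C1\<close> is
    arbitrary.\<close>
  then obtain C1 where C1: "\<And>C. C \<in> ?X \<Longrightarrow> C \<inter> U \<noteq> {} \<Longrightarrow> C = C1"
    by metis
  have "C = C'" if C: "C \<in> ?X" "C' \<in> ?X" "C \<inter> L \<noteq> {}" "C' \<inter> L \<noteq> {}" for C C'
  proof -
    obtain x y where "x \<in> C" "x \<in> L" "y \<in> C'" "y \<in> L"
      using C(3,4) by blast
    moreover from this have "linked ?A x y"
      using sub by (intro linked_below[of x "- N" y]) (auto simp: L_def)
    ultimately show ?thesis
      using C(1,2) by (intro components_eqI[of C _ C' x y])
        (simp_all add: infinite_components_without_def)
  qed
  then obtain C2 where C2: "\<And>C. C \<in> ?X \<Longrightarrow> C \<inter> L \<noteq> {} \<Longrightarrow> C = C2"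
    by metis
  have X: "?X \<subseteq> {C1, C2}"
    using C1 C2 meets by (intro subsetI) (metis insertI1 insertI2)
  then have "card ?X \<le> card {C1, C2}"
    by (intro card_mono) auto
  also have "\<dots> \<le> 2"
    by (simp add: card_insert_if)
  finally show ?thesis
    using X finite_subset by auto
qed

lemma two_ended_Z: "two_ended (with_proj Z)"
proof -
  define S where "S = {x \<in> pverts Z. fst x = 0}"
  let ?X = "infinite_components_without (with_proj Z) S"
  define U where "U = {x \<in> pverts Z. 1 \<le> fst x}"
  define L where "L = {x \<in> pverts Z. fst x \<le> - 1}"
  have S: "finite S" "S \<subseteq> verts (with_proj Z)"
    using finite_levels[of 0 0] by (auto simp: S_def order_antisym_conv conj_commute
        elim!: rev_finite_subset)
  \<comment> \<open>Adjacent levels differ by one and level 0 is gone, so the sign of the level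
    cannot change along a walk.\<close>
  have arcs: "y \<in> pverts Z \<and> fst y \<noteq> 0 \<and> \<bar>fst x - fst y\<bar> = 1"
    if "(x, y) \<in> parcs (mk_symmetric (with_proj Z \<restriction> (pverts Z - S)))" for x y
    using that by (cases x; cases y) (auto simp: parcs_symmetric_restrict parcs_Z S_def)
  have "U \<in> components (with_proj Z \<restriction> (pverts Z - S))"
  proof (rule componentsI)
    show "U \<noteq> {}" using ex_vertex_at_level[of 1] by (auto simp: U_def)
    show "linked (pverts Z - S) x y" if "x \<in> U" "y \<in> U" for x y
      using that by (intro linked_above[of x 1]) (auto simp: U_def S_def)
    show "y \<in> U" if "x \<in> U" "(x, y) \<in> parcs (mk_symmetric (with_proj Z \<restriction> (pverts Z - S)))"
      for x y using that(1) arcs[OF that(2)] by (auto simp: U_def)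
  qed
  moreover have "L \<in> components (with_proj Z \<restriction> (pverts Z - S))"
  proof (rule componentsI)
    show "L \<noteq> {}" using ex_vertex_at_level[of "- 1"] by (auto simp: L_def)
    show "linked (pverts Z - S) x y" if "x \<in> L" "y \<in> L" for x y
      using that by (intro linked_below[of x "- 1"]) (auto simp: L_def S_def)
    show "y \<in> L" if "x \<in> L" "(x, y) \<in> parcs (mk_symmetric (with_proj Z \<restriction> (pverts Z - S)))"
      for x y using that(1) arcs[OF that(2)] by (auto simp: L_def)
  qed
  moreover have "infinite U"
  proof
    assume "finite U"
    \<comment> \<open>Infinitely many levels are occupied.\<close>
    moreover have "{1..} \<subseteq> fst ` U"
      using ex_vertex_at_level by (force simp: U_def)
    ultimately show False
      using infinite_Ici finite_surj by blast
  qed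
  moreover have "infinite L"
  proof
    assume "finite L"
    moreover have "{..- 1} \<subseteq> fst ` L"
      using ex_vertex_at_level by (force simp: L_def)
    ultimately show False
      using infinite_Iic finite_surj by blast
  qed
  ultimately have "{U, L} \<subseteq> ?X"
    by (simp add: infinite_components_without_def)
  moreover have "U \<noteq> L"
    using ex_vertex_at_level[of 1] by (auto simp: U_def L_def)
  ultimately have "card ?X = 2"
    using infinite_components_bound[OF S(1)] card_mono[of ?X "{U, L}"] by simp
  then show ?thesis
    using S connected_Z infinite_components_bound unfolding two_ended_def by blast
qed

end

theorem corollary12:
  fixes D :: "'a pair_pre_digraph" and d k :: nat
  assumes "d \<ge> 2" and "k \<ge> 1"
    and "complete_digraph (d + 1) (with_proj D)"
  shows "pair_wf_digraph (Z_digraph D k) \<and>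
    two_ended (with_proj (Z_digraph D k)) \<and>
    (\<forall>x\<in>pverts (Z_digraph D k).
       in_degree (with_proj (Z_digraph D k)) x = d \<and>
       out_degree (with_proj (Z_digraph D k)) x = d) \<and>
    sharply_k_arc_transitive (Z_digraph D k) k"
proof -
  interpret Z_complete_digraph D d k
    using assms by unfold_locales
  show ?thesis
    using wf_Z two_ended_Z in_degree_Z out_degree_Z k_arc_transitive_Z
      not_Suc_k_arc_transitive_Z
    by (simp add: sharply_k_arc_transitive_def)
qed

end
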